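(* Let $1\le p\le q<\infty$ and let $\omega$ be a discrete weight on $\mathbb{Z}$. Then $l^p_{q\,(\omega)}\subseteq wl^p_{q\,(\omega)}$, with $\|x\|_{wl^p_{q\,(\omega)}}\le\|x\|_{l^p_{q\,(\omega)}}$ for every $x\in l^p_{q\,(\omega)}$.
   Context: A discrete weight on $\mathbb{Z}$ is a sequence $\omega=\{\omega(k)\}_{k\in\mathbb{Z}}$ of positive real numbers; for a finite set $S\subset\mathbb{Z}$, $\omega(S):=\sum_{k\in S}\omega(k)$. Let $\mathbb{N}=\{0,1,2,\dots\}$ and, for $m\in\mathbb{Z}$, $N\in\mathbb{N}$, $S_{m,N}:=\{k\in\mathbb{Z}:|k-m|\le N\}$. $l^p_{q\,(\omega)}$ (discrete weighted Morrey space) is the set of real sequences $x=\{x(k)\}_{k\in\mathbb{Z}}$ with $$\|x\|_{l^p_{q\,(\omega)}}:=\sup_{m\in\mathbb{Z},N\in\mathbb{N}}\omega(S_{m,N})^{\frac1q-\frac1p}\Big(\sum_{k\in S_{m,N}}|x(k)|^p\omega(k)\Big)^{1/p}<\infty.$$ $wl^p_{q\,(\omega)}$ (weighted weak type discrete Morrey space) is the set of real sequences $x=\{x(k)\}_{k\in\mathbb{Z}}$ with $$\|x\|_{wl^p_{q\,(\omega)}}:=\sup_{m\in\mathbb{Z},N\in\mathbb{N},\lambda>0}\omega(S_{m,N})^{\frac1q-\frac1p}\,\lambda\,\omega(\{k\in S_{m,N}:|x(k)|>\lambda\})^{1/p}<\infty.$$ *)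

theory Defs
  imports "HOL-Analysis.Analysis"
begin

definition discrete_weight :: "(int \<Rightarrow> real) \<Rightarrow> bool" where
  "discrete_weight \<omega> \<longleftrightarrow> (\<forall>k. 0 < \<omega> k)"

definition window :: "int \<Rightarrow> nat \<Rightarrow> int set" where
  "window m N = {k. \<bar>k - m\<bar> \<le> int N}"

text \<open>
  The norms below are extended reals, so that the suprema exist for every sequence and
  finiteness is a genuine condition. The weight of a finite set \<open>S\<close> is \<open>sum \<omega> S\<close>.
  Since \<open>0 powr a = 0\<close> for all \<open>a\<close>, the use of \<open>powr\<close> agrees with the usual power for
  exponents \<open>p\<close> and \<open>1 / p\<close> with \<open>p > 0\<close>; the base of the exponent \<open>1 / q - 1 / p\<close> is
  positive for a discrete weight.
\<close>

definition morrey_norm :: "real \<Rightarrow> real \<Rightarrow> (int \<Rightarrow> real) \<Rightarrow> (int \<Rightarrow> real) \<Rightarrow> ereal" where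
  "morrey_norm p q \<omega> x =
    (SUP (m, N) \<in> (UNIV :: (int \<times> nat) set).
      ereal (sum \<omega> (window m N) powr (1 / q - 1 / p)
        * (\<Sum>k\<in>window m N. \<bar>x k\<bar> powr p * \<omega> k) powr (1 / p)))"

definition morrey_space :: "real \<Rightarrow> real \<Rightarrow> (int \<Rightarrow> real) \<Rightarrow> (int \<Rightarrow> real) set" where
  "morrey_space p q \<omega> = {x. morrey_norm p q \<omega> x < \<infinity>}"

definition weak_morrey_norm :: "real \<Rightarrow> real \<Rightarrow> (int \<Rightarrow> real) \<Rightarrow> (int \<Rightarrow> real) \<Rightarrow> ereal" where
  "weak_morrey_norm p q \<omega> x =
    (SUP (m, N, l) \<in> (UNIV :: int set) \<times> (UNIV :: nat set) \<times> {0<..}.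
      ereal (sum \<omega> (window m N) powr (1 / q - 1 / p)
        * l * sum \<omega> {k \<in> window m N. \<bar>x k\<bar> > l} powr (1 / p)))"

definition weak_morrey_space :: "real \<Rightarrow> real \<Rightarrow> (int \<Rightarrow> real) \<Rightarrow> (int \<Rightarrow> real) set" where
  "weak_morrey_space p q \<omega> = {x. weak_morrey_norm p q \<omega> x < \<infinity>}"

end

theory Submission
  imports Defs
begin

text \<open>This is Chebyshev's inequality on each window. Where \<open>\<bar>x k\<bar> > l\<close>,
  \<open>l powr p\<close> is at most \<open>\<bar>x k\<bar> powr p\<close>; summing against the
  weight and taking p-th roots bounds the weak expression (\<open>chebyshev_weighted_sum\<close>).
  Both norms carry the same factor in front, so multiplying by it and passing to suprema compares
  them (\<open>weak_morrey_norm_le_morrey_norm\<close>). The inclusion follows because finiteness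
  passes to the smaller norm.\<close>

lemma finite_window [simp]: "finite (window m N)"
proof -
  have "window m N = {m - int N..m + int N}"
    by (auto simp: window_def)
  then show ?thesis by simp
qed

lemma chebyshev_weighted_sum:
  fixes x w :: "'a \<Rightarrow> real"
  assumes "finite S" and w: "\<And>k. k \<in> S \<Longrightarrow> 0 \<le> w k" and "0 < p" and "0 < l"
  shows "l * sum w {k \<in> S. \<bar>x k\<bar> > l} powr (1 / p)
    \<le> (\<Sum>k\<in>S. \<bar>x k\<bar> powr p * w k) powr (1 / p)"
proof -
  let ?T = "{k \<in> S. \<bar>x k\<bar> > l}"
  have "l powr p * sum w ?T = (\<Sum>k\<in>?T. l powr p * w k)"
    by (rule sum_distrib_left)
  also have "\<dots> \<le> (\<Sum>k\<in>?T. \<bar>x k\<bar> powr p * w k)"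
    using assms by (intro sum_mono mult_right_mono powr_mono2) auto
  \<comment> \<open>The terms added outside the level set are nonnegative.\<close>
  also have "\<dots> \<le> (\<Sum>k\<in>S. \<bar>x k\<bar> powr p * w k)"
    using assms by (intro sum_mono2) auto
  finally have le: "l powr p * sum w ?T \<le> (\<Sum>k\<in>S. \<bar>x k\<bar> powr p * w k)" .
  have nonneg: "0 \<le> sum w ?T"
    using w by (intro sum_nonneg) auto
  \<comment> \<open>Since \<open>l\<close> is positive, it equals
    \<open>(l powr p) powr (1 / p)\<close> and can be moved under the root.\<close>
  have "l * sum w ?T powr (1 / p) = (l powr p * sum w ?T) powr (1 / p)"
    using \<open>0 < p\<close> \<open>0 < l\<close> nonneg by (simp add: powr_mult powr_powr)
  also have "\<dots> \<le> (\<Sum>k\<in>S. \<bar>x k\<bar> powr p * w k) powr (1 / p)"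
    using le nonneg \<open>0 < p\<close> by (intro powr_mono2) auto
  finally show ?thesis .
qed

lemma weak_morrey_norm_le_morrey_norm:
  assumes "0 < p" and "discrete_weight \<omega>"
  shows "weak_morrey_norm p q \<omega> x \<le> morrey_norm p q \<omega> x"
  unfolding weak_morrey_norm_def
proof (rule SUP_least, clarify)
  fix m :: int and N :: nat and l :: real
  assume "0 < l"
  have "sum \<omega> (window m N) powr (1 / q - 1 / p)
        * l * sum \<omega> {k \<in> window m N. \<bar>x k\<bar> > l} powr (1 / p)
      \<le> sum \<omega> (window m N) powr (1 / q - 1 / p)
        * (\<Sum>k\<in>window m N. \<bar>x k\<bar> powr p * \<omega> k) powr (1 / p)"
    \<comment> \<open>Regrouping exposes the common left factor, nonnegative as a value of
      \<open>powr\<close>; what remains is Chebyshev's inequality on the window.\<close>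
    unfolding mult.assoc
    using assms \<open>0 < l\<close>
    by (intro mult_left_mono chebyshev_weighted_sum) (auto simp: discrete_weight_def less_imp_le)
  then show "ereal (sum \<omega> (window m N) powr (1 / q - 1 / p)
        * l * sum \<omega> {k \<in> window m N. \<bar>x k\<bar> > l} powr (1 / p)) \<le> morrey_norm p q \<omega> x"
    \<comment> \<open>The same window serves as witness in the strong supremum, for every level
      \<open>l\<close>.\<close>
    unfolding morrey_norm_def by (intro SUP_upper2[of "(m, N)"]) auto
qed

theorem proposition2p6:
  fixes p q :: real and \<omega> :: "int \<Rightarrow> real"
  assumes "1 \<le> p" and "p \<le> q" and "discrete_weight \<omega>"
  shows "morrey_space p q \<omega> \<subseteq> weak_morrey_space p q \<omega>
    \<and> (\<forall>x \<in> morrey_space p q \<omega>. weak_morrey_norm p q \<omega> x \<le> morrey_norm p q \<omega> x)"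
proof -
  have "weak_morrey_norm p q \<omega> x \<le> morrey_norm p q \<omega> x" for x
    using assms by (intro weak_morrey_norm_le_morrey_norm) auto
  then show ?thesis
    unfolding morrey_space_def weak_morrey_space_def by (blast intro: le_less_trans)
qed

end
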